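(* Suppose that $X$ and $\hat X$ are real random variables on the same probability space and $X$ has a bounded density $f_X$. If $g\in BV$ and $1\le p<\infty$, then for any $1\le q<\infty$ we have $$\mathbb E|g(X)-g(\hat X)|^p\le 3^{p+1}\,(\sup f_X)^{\frac{q}{q+1}}\,V(g)^p\,\|X-\hat X\|_q^{\frac{q}{q+1}}.$$
   Context: $\|Z\|_q=(\mathbb E|Z|^q)^{1/q}$. For $f:\mathbb R\to\mathbb R$ let $T_f(x):=\sup\sum_{j=1}^N|f(x_j)-f(x_{j-1})|$, the supremum being over $N$ and all $-\infty<x_0<x_1<\dots<x_N=x$. Then $f\in BV$ if $V(f):=\lim_{x\to\infty}T_f(x)$ is finite, and $V(f)$ is called the total variation of $f$. *)

theory Defs
  imports "HOL-Probability.Probability"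
begin

text \<open>
  Moments and variations may be infinite, so they live in \<^typ>\<open>ennreal\<close>, which has no real powers
  in the library. The value \<open>\<infinity>\<close> at \<open>\<infinity>\<close> is the usual one for positive exponents only.
\<close>

definition epowr :: "ennreal \<Rightarrow> real \<Rightarrow> ennreal" where
  "epowr x a = (if x = \<infinity> then \<infinity> else ennreal (enn2real x powr a))"

definition Lp_norm :: "'a measure \<Rightarrow> real \<Rightarrow> ('a \<Rightarrow> real) \<Rightarrow> ennreal" where
  "Lp_norm M q Z = epowr (\<integral>\<^sup>+ \<omega>. ennreal (\<bar>Z \<omega>\<bar> powr q) \<partial>M) (1 / q)"

text \<open>
  A partition \<open>x\<^sub>0 < \<dots> < x\<^sub>N = x\<close> is encoded by the values on \<open>{..N}\<close> of a sequence; the other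
  values of the sequence are irrelevant. The choice \<open>N = 0\<close> only contributes the value 0.
\<close>

definition variation_upto :: "(real \<Rightarrow> real) \<Rightarrow> real \<Rightarrow> ennreal" where
  "variation_upto f x =
    (SUP (N, t) \<in> {(N :: nat, t :: nat \<Rightarrow> real). strict_mono_on {..N} t \<and> t N = x}.
      \<Sum>j = 1..N. ennreal \<bar>f (t j) - f (t (j - 1))\<bar>)"

definition total_variation :: "(real \<Rightarrow> real) \<Rightarrow> ennreal" where
  "total_variation f = Lim at_top (variation_upto f)"

definition BV :: "(real \<Rightarrow> real) set" where
  "BV = {f. total_variation f < \<infinity>}"

lemma mono_variation_upto: "mono (variation_upto f)"
proof (rule monoI)
  fix x y :: real
  assume "x \<le> y"
  show "variation_upto f x \<le> variation_upto f y"
  proof (cases "x = y")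
    case False
    with \<open>x \<le> y\<close> have xy: "x < y" by simp
    show ?thesis
      unfolding variation_upto_def
    proof (rule SUP_mono, clarify)
      fix N :: nat and t :: "nat \<Rightarrow> real"
      assume sm: "strict_mono_on {..N} t" and x: "x = t N"
      define t' where "t' = t(Suc N := y)"
      have le: "t i \<le> t N" if "i \<le> N" for i
        using strict_mono_on_leD[OF sm, of i N] that by simp
      have "strict_mono_on {..Suc N} t'"
      proof (rule strict_mono_onI)
        fix i j :: nat assume ij: "i \<in> {..Suc N}" "j \<in> {..Suc N}" "i < j"
        show "t' i < t' j"
        proof (cases "j = Suc N")
          case True
          with ij have "t i \<le> t N" using le[of i] by simp
          then show ?thesis using True ij xy x by (simp add: t'_def)
        next
          case False
          then show ?thesis using ij strict_mono_onD[OF sm, of i j] by (simp add: t'_def)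
        qed
      qed
      moreover have "t' (Suc N) = y" by (simp add: t'_def)
      moreover have "(\<Sum>j = 1..N. ennreal \<bar>f (t j) - f (t (j - 1))\<bar>) \<le>
          (\<Sum>j = 1..Suc N. ennreal \<bar>f (t' j) - f (t' (j - 1))\<bar>)"
      proof -
        have "(\<Sum>j = 1..N. ennreal \<bar>f (t j) - f (t (j - 1))\<bar>) =
            (\<Sum>j = 1..N. ennreal \<bar>f (t' j) - f (t' (j - 1))\<bar>)"
          by (intro sum.cong) (auto simp: t'_def)
        also have "\<dots> \<le> (\<Sum>j = 1..Suc N. ennreal \<bar>f (t' j) - f (t' (j - 1))\<bar>)"
          by (intro sum_mono2) auto
        finally show ?thesis .
      qed
      ultimately show "\<exists>m\<in>{(N :: nat, t :: nat \<Rightarrow> real). strict_mono_on {..N} t \<and> t N = y}.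
          (\<Sum>j = 1..N. ennreal \<bar>f (t j) - f (t (j - 1))\<bar>)
          \<le> (case m of (N, t) \<Rightarrow> \<Sum>j = 1..N. ennreal \<bar>f (t j) - f (t (j - 1))\<bar>)"
        by (intro bexI[of _ "(Suc N, t')"]) auto
    qed
  qed simp
qed

text \<open>The limit defining the total variation always exists in \<^typ>\<open>ennreal\<close>.\<close>

lemma variation_upto_tendsto:
  "(variation_upto f \<longlongrightarrow> total_variation f) at_top"
proof -
  have "(variation_upto f \<longlongrightarrow> (SUP x. variation_upto f x)) at_top"
  proof (rule order_tendstoI)
    fix a assume "a < (SUP x. variation_upto f x)"
    then obtain x where x: "a < variation_upto f x" by (auto simp: less_SUP_iff)
    show "eventually (\<lambda>y. a < variation_upto f y) at_top"
      using eventually_ge_at_top[of x]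
      by eventually_elim (use x monoD[OF mono_variation_upto, of x _ f] in \<open>blast intro: less_le_trans\<close>)
  next
    fix a assume "(SUP x. variation_upto f x) < a"
    then show "eventually (\<lambda>y. variation_upto f y < a) at_top"
      by (intro always_eventually allI) (meson SUP_upper UNIV_I le_less_trans)
  qed
  then show ?thesis
    unfolding total_variation_def using tendsto_Lim[OF trivial_limit_at_top_linorder] by metis
qed

end

theory Submission
  imports Defs
begin

text \<open>
  With \<open>h = variation_upto g\<close>, which is nondecreasing with values in \<open>[0, V]\<close>, we have
  \<open>\<bar>g x - g y\<bar> \<le> \<bar>h x - h y\<bar>\<close>, so
  \<open>E \<bar>g X - g X'\<bar>\<^sup>p \<le> V\<^sup>p\<^sup>-\<^sup>1 E \<bar>h X - h X'\<bar>\<close>. By the layer cake formula the last expectation is the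
  integral over \<open>s \<in> [0, V]\<close> of the probability that exactly one of \<open>X\<close>, \<open>X'\<close> lies in the half-line
  \<open>{h > s}\<close>. If this half-line has end point \<open>K\<close>, then for every \<open>d > 0\<close> that event forces
  \<open>\<bar>X - K\<bar> \<le> d\<close> or \<open>\<bar>X - X'\<bar> > d\<close>, so its probability is at most
  \<open>2 d sup f\<^sub>X + d\<^sup>-\<^sup>q E \<bar>X - X'\<bar>\<^sup>q\<close>; choosing \<open>d\<close> to balance the two terms gives the factor 3.
\<close>

lemma epowr_ennreal: "0 \<le> x \<Longrightarrow> epowr (ennreal x) a = ennreal (x powr a)"
  by (simp add: epowr_def)

section \<open>A monotone majorant for functions of bounded variation\<close>

text \<open>Appending \<open>y\<close> to a partition that ends at \<open>x\<close> adds exactly the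
  term for the last gap. Taking the supremum over partitions ending at \<open>x\<close> gives the
  bound.\<close>

lemma variation_upto_add_le:
  assumes "x < y"
  shows "ennreal \<bar>f y - f x\<bar> + variation_upto f x \<le> variation_upto f y"
proof -
  let ?P = "\<lambda>x. {(N :: nat, t :: nat \<Rightarrow> real). strict_mono_on {..N} t \<and> t N = x}"
  let ?S = "\<lambda>N t. \<Sum>j = 1..N. ennreal \<bar>f (t j) - f (t (j - 1))\<bar>"
  \<comment> \<open>The one-point partition makes the index set nonempty, so that a constant may be
    moved inside the supremum.\<close>
  have "(0, \<lambda>_. x) \<in> ?P x"
    by (auto simp: strict_mono_on_def)
  then have ne: "?P x \<noteq> {}" by blast
  have "ennreal \<bar>f y - f x\<bar> + variation_upto f x
    = (SUP m\<in>?P x. ennreal \<bar>f y - f x\<bar> + (case m of (N, t) \<Rightarrow> ?S N t))"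
    unfolding variation_upto_def using ennreal_SUP_add_right[OF ne] by simp
  also have "\<dots> \<le> variation_upto f y"
    unfolding variation_upto_def
  proof (rule SUP_mono, clarify)
    fix N :: nat and t :: "nat \<Rightarrow> real"
    assume sm: "strict_mono_on {..N} t" and x: "x = t N"
    define t' where "t' = t(Suc N := y)"
    have le: "t i \<le> t N" if "i \<le> N" for i
      using strict_mono_on_leD[OF sm, of i N] that by simp
    have "strict_mono_on {..Suc N} t'"
    proof (rule strict_mono_onI)
      fix i j :: nat assume ij: "i \<in> {..Suc N}" "j \<in> {..Suc N}" "i < j"
      show "t' i < t' j"
      proof (cases "j = Suc N")
        case True
        with ij have "t i \<le> t N" using le[of i] by simp
        then show ?thesis using True ij assms x by (simp add: t'_def)
      next
        case False
        then show ?thesis using ij strict_mono_onD[OF sm, of i j] by (simp add: t'_def)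
      qed
    qed
    moreover have "ennreal \<bar>f y - f (t N)\<bar> + ?S N t = ?S (Suc N) t'"
    proof -
      have "?S N t = ?S N t'"
        by (intro sum.cong) (auto simp: t'_def)
      then show ?thesis by (simp add: t'_def add.commute)
    qed
    ultimately show "\<exists>m\<in>?P y. ennreal \<bar>f y - f (t N)\<bar> + ?S N t \<le> (case m of (N, t) \<Rightarrow> ?S N t)"
      by (intro bexI[of _ "(Suc N, t')"]) (auto simp: t'_def)
  qed
  finally show ?thesis .
qed

lemma variation_upto_le_total: "variation_upto f x \<le> total_variation f"
proof (rule tendsto_lowerbound[OF variation_upto_tendsto])
  show "\<forall>\<^sub>F y in at_top. variation_upto f x \<le> variation_upto f y"
    using eventually_ge_at_top[of x] by eventually_elim (rule monoD[OF mono_variation_upto])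
qed simp

text \<open>\<open>h\<close> is the variation function read as a real function; it is finite because
  the total variation bounds it. The increments of \<open>g\<close> are controlled through
  \<open>variation_upto_add_le\<close>, with no loss of constant, so the estimate need only be
  proved for a monotone function.\<close>

lemma BV_monotone_majorant:
  assumes "g \<in> BV"
  obtains h :: "real \<Rightarrow> real" and v :: real where
    "total_variation g = ennreal v" "0 \<le> v" "mono h" "\<And>x. 0 \<le> h x" "\<And>x. h x \<le> v"
    "\<And>x y. \<bar>g x - g y\<bar> \<le> \<bar>h x - h y\<bar>"
proof -
  obtain v where v: "0 \<le> v" "total_variation g = ennreal v"
    using assms by (cases "total_variation g") (auto simp: BV_def)
  define h where "h x = enn2real (variation_upto g x)" for x
  have fin: "variation_upto g x < top" for x
    using variation_upto_le_total[of g x] v by (simp add: le_less_trans)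
  have h: "ennreal (h x) = variation_upto g x" for x
    using fin by (simp add: h_def)
  have h0: "0 \<le> h x" for x
    by (simp add: h_def)
  have hv: "h x \<le> v" for x
    using variation_upto_le_total[of g x] unfolding h[symmetric] v(2) ennreal_le_iff[OF v(1)] .
  have incr: "\<bar>g y - g x\<bar> + h x \<le> h y" if "x < y" for x y
    using variation_upto_add_le[OF that, of g]
    by (simp add: h[symmetric] h0 flip: ennreal_plus)
  have "mono h"
  proof (rule monoI)
    fix x y :: real assume "x \<le> y"
    then show "h x \<le> h y" using incr[of x y] by (cases "x = y") auto
  qed
  moreover have "\<bar>g x - g y\<bar> \<le> \<bar>h x - h y\<bar>" for x y
    using incr[of x y] incr[of y x] by (cases x y rule: linorder_cases) auto
  ultimately show thesis
    using that v h0 hv by blast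
qed

section \<open>Probability that a half-line separates the two variables\<close>

text \<open>\<open>K\<close> is the end point \<open>Inf U\<close>, which lies between any two
  points that \<open>U\<close> separates, whether or not it belongs to \<open>U\<close>. If
  \<open>U\<close> is empty or the whole line, nothing is separated and any \<open>K\<close> will
  do.\<close>

lemma up_closed_separation:
  fixes U :: "real set"
  assumes up: "\<And>x y. x \<in> U \<Longrightarrow> x \<le> y \<Longrightarrow> y \<in> U"
  obtains K where "\<And>x y d. (x \<in> U) \<noteq> (y \<in> U) \<Longrightarrow> \<bar>x - y\<bar> \<le> d \<Longrightarrow> \<bar>x - K\<bar> \<le> d"
proof (cases "U = {} \<or> U = UNIV")
  case True
  then show thesis using that by blast
next
  case False
  then obtain a where a: "a \<notin> U" by blast
  have below: "y \<le> x" if "x \<in> U" "y \<notin> U" for x y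
    using up that by (meson linear)
  have bdd: "bdd_below U"
    using below a by (auto intro: bdd_belowI[of _ a])
  have lo: "Inf U \<le> x" if "x \<in> U" for x
    using that bdd by (rule cInf_lower)
  have hi: "y \<le> Inf U" if "y \<notin> U" for y
    using False below that by (intro cInf_greatest) auto
  have "\<bar>x - Inf U\<bar> \<le> d" if "(x \<in> U) \<noteq> (y \<in> U)" "\<bar>x - y\<bar> \<le> d" for x y d
    using that lo[of x] lo[of y] hi[of x] hi[of y] by (cases "x \<in> U") auto
  then show thesis by (rule that)
qed

lemma emeasure_density_interval_le:
  assumes D: "distributed M lborel X (\<lambda>x. ennreal (f x))"
    and "\<And>x. f x \<le> S" and "0 \<le> S" and "a \<le> b"
  shows "emeasure M {\<omega> \<in> space M. X \<omega> \<in> {a..b}} \<le> ennreal (S * (b - a))"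
proof -
  have "emeasure M {\<omega> \<in> space M. X \<omega> \<in> {a..b}} = emeasure M (X -` {a..b} \<inter> space M)"
    by (intro arg_cong[where f="emeasure M"]) auto
  also have "\<dots> = (\<integral>\<^sup>+x. ennreal (f x) * indicator {a..b} x \<partial>lborel)"
    by (rule distributed_emeasure[OF D]) simp
  also have "\<dots> \<le> (\<integral>\<^sup>+x. ennreal S * indicator {a..b} x \<partial>lborel)"
    using assms by (intro nn_integral_mono mult_right_mono ennreal_leI) auto
  also have "\<dots> = ennreal (S * (b - a))"
    using assms by (simp add: nn_integral_cmult_indicator ennreal_mult)
  finally show ?thesis .
qed

text \<open>Markov's inequality for the \<open>q\<close>-th absolute moment, in a form that allows
  this moment to be infinite.\<close>

lemma emeasure_abs_gt_le:
  fixes Z :: "'a \<Rightarrow> real"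
  assumes [measurable]: "Z \<in> borel_measurable M" and "0 < d" "0 \<le> q"
  shows "emeasure M {\<omega> \<in> space M. d < \<bar>Z \<omega>\<bar>}
    \<le> ennreal (d powr - q) * (\<integral>\<^sup>+ \<omega>. ennreal (\<bar>Z \<omega>\<bar> powr q) \<partial>M)"
proof -
  have "emeasure M {\<omega> \<in> space M. d < \<bar>Z \<omega>\<bar>} = (\<integral>\<^sup>+ \<omega>. indicator {\<omega> \<in> space M. d < \<bar>Z \<omega>\<bar>} \<omega> \<partial>M)"
    by simp
  also have "\<dots> \<le> (\<integral>\<^sup>+ \<omega>. ennreal (d powr - q) * ennreal (\<bar>Z \<omega>\<bar> powr q) \<partial>M)"
  proof (rule nn_integral_mono)
    fix \<omega>
    have "1 \<le> d powr - q * \<bar>Z \<omega>\<bar> powr q" if "d < \<bar>Z \<omega>\<bar>"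
    proof -
      have "1 = d powr - q * d powr q" using assms by (simp add: powr_minus)
      also have "\<dots> \<le> d powr - q * \<bar>Z \<omega>\<bar> powr q"
        using assms that by (intro mult_left_mono powr_mono2) auto
      finally show ?thesis .
    qed
    then show "indicator {\<omega> \<in> space M. d < \<bar>Z \<omega>\<bar>} \<omega>
        \<le> ennreal (d powr - q) * ennreal (\<bar>Z \<omega>\<bar> powr q)"
      by (auto simp: indicator_def simp flip: ennreal_mult)
  qed
  also have "\<dots> = ennreal (d powr - q) * (\<integral>\<^sup>+ \<omega>. ennreal (\<bar>Z \<omega>\<bar> powr q) \<partial>M)"
    by (intro nn_integral_cmult) measurable
  finally show ?thesis .
qed

text \<open>This \<open>d\<close> solves \<open>S * d = d powr - q * D\<close>, that is, d^(q+1) =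
  D/S. Both sides then equal S^(q/(q+1)) D^(1/(q+1)); the interval of length \<open>2 * d\<close>
  counts this value twice and the tail once, hence the 3.\<close>

lemma balanced_sum:
  fixes S D q :: real
  assumes "0 < S" "0 < D" "1 \<le> q"
  defines "d \<equiv> (D / S) powr (1 / (q + 1))"
  shows "S * (2 * d) + d powr - q * D = 3 * (S powr (q / (q + 1)) * D powr (1 / (q + 1)))"
proof -
  have e: "1 - 1 / (q + 1) = q / (q + 1)"
    using assms by (simp add: field_simps)
  have S: "S * d = S powr (1 - 1 / (q + 1)) * D powr (1 / (q + 1))"
    using assms by (simp add: powr_divide powr_diff)
  have "d powr - q = D powr (- (q / (q + 1))) * S powr (q / (q + 1))"
    using assms by (simp add: d_def powr_powr powr_divide powr_minus field_simps)
  moreover have "D powr (- (q / (q + 1))) * D = D powr (1 - q / (q + 1))"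
    using assms(2) by (simp add: powr_diff powr_minus field_simps)
  ultimately have "d powr - q * D = S powr (q / (q + 1)) * D powr (1 - q / (q + 1))"
    by (simp add: mult_ac)
  moreover have "1 - q / (q + 1) = 1 / (q + 1)"
    using assms by (simp add: field_simps)
  ultimately show ?thesis using S e by simp
qed

lemma emeasure_separated_le:
  fixes X X' :: "'a \<Rightarrow> real" and f :: "real \<Rightarrow> real" and U :: "real set"
  assumes [measurable]: "X \<in> borel_measurable M" "X' \<in> borel_measurable M" "U \<in> sets borel"
    and D: "distributed M lborel X (\<lambda>x. ennreal (f x))"
    and f: "\<And>x. f x \<le> S" and S: "0 < S" and q: "1 \<le> q"
    and up: "\<And>x y. x \<in> U \<Longrightarrow> x \<le> y \<Longrightarrow> y \<in> U"
  shows "emeasure M {\<omega> \<in> space M. (X \<omega> \<in> U) \<noteq> (X' \<omega> \<in> U)}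
    \<le> ennreal (3 * S powr (q / (q + 1))) * epowr (Lp_norm M q (\<lambda>\<omega>. X \<omega> - X' \<omega>)) (q / (q + 1))"
    (is "emeasure M ?A \<le> _")
proof -
  let ?I = "\<integral>\<^sup>+ \<omega>. ennreal (\<bar>X \<omega> - X' \<omega>\<bar> powr q) \<partial>M"
  consider "?I = top" | "?I = 0" | i where "?I = ennreal i" "0 < i"
    by (cases ?I) (auto simp: less_le)
  then show ?thesis
  proof cases
    case 1
    \<comment> \<open>The norm is infinite, and positivity of \<open>S\<close> keeps the product on
      the right from being 0 times infinity.\<close>
    then show ?thesis using S by (simp add: Lp_norm_def epowr_def ennreal_mult_top)
  next
    \<comment> \<open>Here the balancing \<open>d\<close> would degenerate to 0. Instead,
      \<open>X\<close> and \<open>X'\<close> agree almost everywhere, so the event is null.\<close>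
    case 2
    then have "AE \<omega> in M. ennreal (\<bar>X \<omega> - X' \<omega>\<bar> powr q) = 0"
      by (subst (asm) nn_integral_0_iff_AE) measurable
    then have "AE \<omega> in M. \<omega> \<notin> ?A"
      by eventually_elim (auto simp: ennreal_eq_0_iff)
    then have "emeasure M ?A = 0"
      by (subst (asm) AE_iff_measurable[OF _ refl]) auto
    then show ?thesis by simp
  next
    case 3
    define d where "d = (i / S) powr (1 / (q + 1))"
    have d: "0 < d" using 3 S by (simp add: d_def)
    obtain K where K: "\<And>x y d. (x \<in> U) \<noteq> (y \<in> U) \<Longrightarrow> \<bar>x - y\<bar> \<le> d \<Longrightarrow> \<bar>x - K\<bar> \<le> d"
      by (rule up_closed_separation[of U]) (use up in blast)+
    let ?B = "{\<omega> \<in> space M. X \<omega> \<in> {K - d..K + d}}"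
    let ?C = "{\<omega> \<in> space M. d < \<bar>X \<omega> - X' \<omega>\<bar>}"
    have "?A \<subseteq> ?B \<union> ?C"
    proof
      fix \<omega> assume "\<omega> \<in> ?A"
      then show "\<omega> \<in> ?B \<union> ?C"
        using K[of "X \<omega>" "X' \<omega>" d] by (cases "\<bar>X \<omega> - X' \<omega>\<bar> \<le> d") auto
    qed
    then have "emeasure M ?A \<le> emeasure M (?B \<union> ?C)"
      by (intro emeasure_mono) auto
    also have "\<dots> \<le> emeasure M ?B + emeasure M ?C"
      by (intro emeasure_subadditive) auto
    also have "\<dots> \<le> ennreal (S * (2 * d)) + ennreal (d powr - q) * ennreal i"
      using emeasure_density_interval_le[OF D f, of "K - d" "K + d"] S d q
        emeasure_abs_gt_le[of "\<lambda>\<omega>. X \<omega> - X' \<omega>" M d q]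
      by (intro add_mono) (auto simp: 3(1)[symmetric])
    also have "\<dots> = ennreal (S * (2 * d) + d powr - q * i)"
      using S d 3(2) by (simp add: ennreal_mult)
    also have "S * (2 * d) + d powr - q * i = 3 * (S powr (q / (q + 1)) * i powr (1 / (q + 1)))"
      unfolding d_def by (rule balanced_sum) fact+
    \<comment> \<open>The norm is \<open>i powr (1 / q)\<close>, and raising it to the power q/(q+1)
      leaves the exponent 1/(q+1).\<close>
    also have "ennreal \<dots> = ennreal (3 * S powr (q / (q + 1)))
        * epowr (Lp_norm M q (\<lambda>\<omega>. X \<omega> - X' \<omega>)) (q / (q + 1))"
      using 3 q by (simp add: Lp_norm_def epowr_ennreal powr_powr mult.assoc flip: ennreal_mult)
    finally show ?thesis .
  qed
qed

section \<open>Layer cake formula\<close>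

text \<open>The distance of two reals is the Lebesgue measure of the levels \<open>s\<close>
  separating them, so Tonelli's theorem turns the expectation into an integral over
  \<open>s\<close>. Levels outside \<open>{0..v}\<close> separate nothing, which leaves a range of
  length \<open>v\<close>.\<close>

lemma nn_integral_abs_diff_le:
  fixes Y Y' :: "'a \<Rightarrow> real"
  assumes "sigma_finite_measure M"
    and [measurable]: "Y \<in> borel_measurable M" "Y' \<in> borel_measurable M"
    and Y: "\<And>\<omega>. 0 \<le> Y \<omega>" "\<And>\<omega>. Y \<omega> \<le> v" "\<And>\<omega>. 0 \<le> Y' \<omega>" "\<And>\<omega>. Y' \<omega> \<le> v" and v: "0 \<le> v"
    and B: "\<And>s. emeasure M {\<omega> \<in> space M. (s < Y \<omega>) \<noteq> (s < Y' \<omega>)} \<le> B"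
  shows "(\<integral>\<^sup>+ \<omega>. ennreal \<bar>Y \<omega> - Y' \<omega>\<bar> \<partial>M) \<le> ennreal v * B"
proof -
  interpret pair_sigma_finite M "lborel :: real measure"
    using assms(1) by (intro pair_sigma_finite.intro lborel.sigma_finite_measure_axioms)
  let ?i = "\<lambda>\<omega> s. indicator {s. (s < Y \<omega>) \<noteq> (s < Y' \<omega>)} s :: ennreal"
  have [measurable]: "(\<lambda>(\<omega>, s). ?i \<omega> s) \<in> borel_measurable (M \<Otimes>\<^sub>M lborel)"
    unfolding indicator_def by measurable
  have "ennreal \<bar>Y \<omega> - Y' \<omega>\<bar> = (\<integral>\<^sup>+ s. ?i \<omega> s \<partial>lborel)" for \<omega>
  proof -
    have *: "{s. (s < Y \<omega>) \<noteq> (s < Y' \<omega>)} = {min (Y \<omega>) (Y' \<omega>)..<max (Y \<omega>) (Y' \<omega>)}"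
      by auto
    show ?thesis unfolding * by (subst nn_integral_indicator) (auto simp: max_def min_def)
  qed
  then have "(\<integral>\<^sup>+ \<omega>. ennreal \<bar>Y \<omega> - Y' \<omega>\<bar> \<partial>M) = (\<integral>\<^sup>+ \<omega>. \<integral>\<^sup>+ s. ?i \<omega> s \<partial>lborel \<partial>M)"
    by simp
  also have "\<dots> = (\<integral>\<^sup>+ s. \<integral>\<^sup>+ \<omega>. ?i \<omega> s \<partial>M \<partial>lborel)"
    using Fubini'[of ?i] by simp
  also have "\<dots> \<le> (\<integral>\<^sup>+ s. B * indicator {0..v} s \<partial>lborel)"
  proof (rule nn_integral_mono)
    fix s :: real
    have "(\<integral>\<^sup>+ \<omega>. ?i \<omega> s \<partial>M)
        = (\<integral>\<^sup>+ \<omega>. indicator {\<omega> \<in> space M. (s < Y \<omega>) \<noteq> (s < Y' \<omega>)} \<omega> \<partial>M)"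
      by (intro nn_integral_cong) (auto simp: indicator_def)
    also have "\<dots> = emeasure M {\<omega> \<in> space M. (s < Y \<omega>) \<noteq> (s < Y' \<omega>)}"
      by simp
    also have "\<dots> \<le> B * indicator {0..v} s"
    proof (cases "s \<in> {0..v}")
      case False
      have "(s < Y \<omega>) = (s < Y' \<omega>)" for \<omega>
        using False Y(1-4)[of \<omega>] by auto
      then show ?thesis by simp
    qed (use B in simp)
    finally show "(\<integral>\<^sup>+ \<omega>. ?i \<omega> s \<partial>M) \<le> B * indicator {0..v} s" .
  qed
  also have "\<dots> = ennreal v * B"
    using v by (simp add: nn_integral_cmult_indicator mult.commute)
  finally show ?thesis .
qed

section \<open>The moment bound\<close>

text \<open>Otherwise the density would vanish and the total mass would be 0. Positivity is needed
  because the choice of \<open>d\<close> divides by \<open>S\<close>.\<close>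

lemma distributed_sup_pos:
  assumes "prob_space M" and D: "distributed M lborel X (\<lambda>x. ennreal (f x))"
    and "\<And>x. f x \<le> (S :: real)"
  shows "0 < S"
proof (rule ccontr)
  interpret prob_space M by fact
  assume "\<not> 0 < S"
  then have "f x \<le> 0" for x using assms(3)[of x] by simp
  then have "emeasure M (X -` UNIV \<inter> space M) = 0"
    by (subst distributed_emeasure[OF D]) (auto simp: ennreal_neg)
  then show False by (simp add: emeasure_space_1)
qed

lemma nn_integral_BV_diff_le:
  fixes X X' :: "'a \<Rightarrow> real" and f g :: "real \<Rightarrow> real" and p q S :: real
  assumes "prob_space M"
    and X [measurable]: "X \<in> borel_measurable M" "X' \<in> borel_measurable M"
    and D: "distributed M lborel X (\<lambda>x. ennreal (f x))"
    and f: "\<And>x. f x \<le> S" and g: "g \<in> BV" and p: "1 \<le> p" and q: "1 \<le> q"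
  shows "(\<integral>\<^sup>+ \<omega>. ennreal (\<bar>g (X \<omega>) - g (X' \<omega>)\<bar> powr p) \<partial>M)
    \<le> ennreal (3 * S powr (q / (q + 1))) * epowr (total_variation g) p
      * epowr (Lp_norm M q (\<lambda>\<omega>. X \<omega> - X' \<omega>)) (q / (q + 1))"
proof -
  interpret prob_space M by fact
  have S: "0 < S"
    using assms(1) D f by (rule distributed_sup_pos)
  obtain v h where v: "total_variation g = ennreal v" "0 \<le> v" and "mono h"
    and h: "\<And>x. 0 \<le> h x" "\<And>x. h x \<le> v" "\<And>x y. \<bar>g x - g y\<bar> \<le> \<bar>h x - h y\<bar>"
    by (rule BV_monotone_majorant[OF g]) (rule that)
  have [measurable]: "h \<in> borel_measurable borel"
    using \<open>mono h\<close> by (rule borel_measurable_mono)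
  define E where "E = epowr (Lp_norm M q (\<lambda>\<omega>. X \<omega> - X' \<omega>)) (q / (q + 1))"
  \<comment> \<open>As \<open>h\<close> is monotone, each level set \<open>{x. s < h x}\<close> is
    upward closed, and the resulting bound does not depend on \<open>s\<close>.\<close>
  have half_line: "emeasure M {\<omega> \<in> space M. (s < h (X \<omega>)) \<noteq> (s < h (X' \<omega>))}
      \<le> ennreal (3 * S powr (q / (q + 1))) * E" for s
  proof -
    have "{x. s < h x} \<in> sets borel" by measurable
    moreover have "y \<in> {x. s < h x}" if "x \<in> {x. s < h x}" "x \<le> y" for x y
      using that monoD[OF \<open>mono h\<close>, of x y] by simp
    ultimately show ?thesis
      using emeasure_separated_le[OF X _ D f S q, of "{x. s < h x}"]
      unfolding E_def by simp
  qed
  \<comment> \<open>One factor of the \<open>p\<close>-th power is kept for the layer cake formula;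
    the remaining power \<open>p - 1\<close> is bounded using that \<open>h\<close> takes values
    between 0 and \<open>v\<close>.\<close>
  have pointwise: "\<bar>g x - g y\<bar> powr p \<le> v powr (p - 1) * \<bar>h x - h y\<bar>" for x y
  proof (cases "h x = h y")
    case True
    then show ?thesis using h(3)[of x y] by simp
  next
    case False
    have "\<bar>g x - g y\<bar> powr p \<le> \<bar>h x - h y\<bar> powr p"
      using h(3) p by (intro powr_mono2) auto
    also have "\<dots> = \<bar>h x - h y\<bar> powr (p - 1) * \<bar>h x - h y\<bar>"
      using False by (simp add: powr_diff)
    also have "\<dots> \<le> v powr (p - 1) * \<bar>h x - h y\<bar>"
      using h(1,2)[of x] h(1,2)[of y] p by (intro mult_right_mono powr_mono2) auto
    finally show ?thesis .
  qed
  have "(\<integral>\<^sup>+ \<omega>. ennreal (\<bar>g (X \<omega>) - g (X' \<omega>)\<bar> powr p) \<partial>M)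
      \<le> (\<integral>\<^sup>+ \<omega>. ennreal (v powr (p - 1)) * ennreal \<bar>h (X \<omega>) - h (X' \<omega>)\<bar> \<partial>M)"
    using pointwise by (intro nn_integral_mono) (simp flip: ennreal_mult)
  also have "\<dots> = ennreal (v powr (p - 1)) * (\<integral>\<^sup>+ \<omega>. ennreal \<bar>h (X \<omega>) - h (X' \<omega>)\<bar> \<partial>M)"
    by (intro nn_integral_cmult) measurable
  also have "\<dots> \<le> ennreal (v powr (p - 1)) * (ennreal v * (ennreal (3 * S powr (q / (q + 1))) * E))"
    using h v(2) half_line sigma_finite_measure_axioms
    by (intro mult_left_mono nn_integral_abs_diff_le) auto
  also have "\<dots> = ennreal (v powr (p - 1) * v * (3 * S powr (q / (q + 1)))) * E"
    using v(2) by (simp add: ennreal_mult mult.assoc)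
  \<comment> \<open>For \<open>v = 0\<close> both sides are 0; otherwise the division introduced by
    \<open>powr_diff\<close> cancels.\<close>
  also have "v powr (p - 1) * v = v powr p"
    using v(2) by (cases "v = 0") (auto simp: powr_diff)
  also have "ennreal (v powr p * (3 * S powr (q / (q + 1)))) * E
      = ennreal (3 * S powr (q / (q + 1))) * epowr (total_variation g) p * E"
    using v by (simp add: epowr_ennreal ennreal_mult ac_simps)
  finally show ?thesis
    unfolding E_def .
qed

theorem theorem4p3:
  fixes M :: "'a measure" and X X' :: "'a \<Rightarrow> real"
    and f\<^sub>X g :: "real \<Rightarrow> real" and p q :: real
  assumes "prob_space M"
    and "X \<in> borel_measurable M" and "X' \<in> borel_measurable M"
    and "\<And>x. 0 \<le> f\<^sub>X x"
    and "distributed M lborel X (\<lambda>x. ennreal (f\<^sub>X x))"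
    and "bdd_above (range f\<^sub>X)"
    and "g \<in> BV"
    and "1 \<le> p" and "1 \<le> q"
  shows "(\<integral>\<^sup>+ \<omega>. ennreal (\<bar>g (X \<omega>) - g (X' \<omega>)\<bar> powr p) \<partial>M)
    \<le> ennreal (3 powr (p + 1))
      * ennreal ((SUP x. f\<^sub>X x) powr (q / (q + 1)))
      * epowr (total_variation g) p
      * epowr (Lp_norm M q (\<lambda>\<omega>. X \<omega> - X' \<omega>)) (q / (q + 1))"
proof -
  \<comment> \<open>Boundedness of the density is what makes the real-valued \<open>SUP\<close> an
    upper bound.\<close>
  have "f\<^sub>X x \<le> (SUP x. f\<^sub>X x)" for x
    by (rule cSUP_upper) (use assms(6) in auto)
  note nn_integral_BV_diff_le[OF assms(1-3,5) this assms(7-9)]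
  \<comment> \<open>The argument yields the constant 3, which is at most 3^(p+1).\<close>
  also have "ennreal (3 * (SUP x. f\<^sub>X x) powr (q / (q + 1)))
      \<le> ennreal (3 powr (p + 1)) * ennreal ((SUP x. f\<^sub>X x) powr (q / (q + 1)))"
    using powr_mono[of 1 "p + 1" "3 :: real"] assms(8)
    by (auto simp flip: ennreal_mult intro!: ennreal_leI mult_right_mono)
  finally show ?thesis
    by (simp add: mult_right_mono)
qed

end
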